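(* Let $\rho,\sigma$ be gauges and let $(x_n)_n:{}^{\sigma}\widetilde{\mathbb N}\to{}^{\rho}\widetilde{\mathbb R}$ be a hypersequence. Then $(x_n)_n$ is convergent (i.e. it has a hyperlimit in ${}^{\rho}\widetilde{\mathbb R}$) if and only if it is a Cauchy hypersequence.
   Context: Let $I=(0,1]$. A gauge is a net $\rho=(\rho_\varepsilon)_{\varepsilon\in I}\in(0,1]^I$ with $\rho_\varepsilon\to0$ as $\varepsilon\to0^+$. "$\forall^0\varepsilon:\ P(\varepsilon)$" means: there is $\varepsilon_0\in I$ such that $P(\varepsilon)$ holds for all $\varepsilon\in(0,\varepsilon_0]$. $\mathbb R_\rho$ is the ring of $\rho$-moderate nets: $(x_\varepsilon)\in\mathbb R^I$ with $\exists N\in\mathbb N\,\forall^0\varepsilon:\ |x_\varepsilon|\le\rho_\varepsilon^{-N}$. Write $(x_\varepsilon)\sim_\rho(y_\varepsilon)$ if $\forall n\in\mathbb N\,\forall^0\varepsilon:\ |x_\varepsilon-y_\varepsilon|\le\rho_\varepsilon^n$; a net is $\rho$-negligible if it is $\sim_\rho 0$. ${}^{\rho}\widetilde{\mathbb R}:=\mathbb R_\rho/\sim_\rho$ (a ring with pointwise operations); classes are denoted $[x_\varepsilon]$. Order: $[x_\varepsilon]\le[y_\varepsilon]$ iff there is a $\rho$-negligible $(z_\varepsilon)$ with $\forall^0\varepsilon:\ x_\varepsilon\le y_\varepsilon+z_\varepsilon$; $x<y$ means $x\le y$ and $y-x$ is invertible. $|[x_\varepsilon]|:=[|x_\varepsilon|]$,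 and $\mathrm d\rho:=[\rho_\varepsilon]$. Given a gauge $\sigma$, ${}^{\sigma}\widetilde{\mathbb N}:=\{[n_\varepsilon]\in{}^{\sigma}\widetilde{\mathbb R}\mid n_\varepsilon\in\mathbb N\ \forall\varepsilon\}$, ordered by the order $\le$ of ${}^{\sigma}\widetilde{\mathbb R}$, and ${}^{\sigma}\widetilde{\mathbb N}_{\ge M}:=\{n\in{}^{\sigma}\widetilde{\mathbb N}\mid n\ge M\}$. A hypersequence is a map $x:{}^{\sigma}\widetilde{\mathbb N}\to{}^{\rho}\widetilde{\mathbb R}$, $x_n:=x(n)$. An element $l\in{}^{\rho}\widetilde{\mathbb R}$ is the hyperlimit of $(x_n)_n$ if $\forall q\in\mathbb N\,\exists M\in{}^{\sigma}\widetilde{\mathbb N}\,\forall n\in{}^{\sigma}\widetilde{\mathbb N}_{\ge M}:\ |x_n-l|<\mathrm d\rho^q$. $(x_n)_n$ is a Cauchy hypersequence if $\forall q\in\mathbb N\,\exists M\in{}^{\sigma}\widetilde{\mathbb N}\,\forall n,m\in{}^{\sigma}\widetilde{\mathbb N}_{\ge M}:\ |x_n-x_m|<\mathrm d\rho^q$. *)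

theory Defs
  imports Complex_Main "HOL-Algebra.Ring"
begin

text \<open>
  Nets indexed by \<open>I = (0,1]\<close> are modelled as total functions on the reals; every predicate
  below inspects them on \<open>I\<close> only, so the values outside \<open>I\<close> are absorbed by the quotient.
\<close>

type_synonym net = "real \<Rightarrow> real"

definition small :: "(real \<Rightarrow> bool) \<Rightarrow> bool" (binder \<open>\<forall>\<^sup>0\<close> 10) where
  "small P \<longleftrightarrow> (\<exists>e0\<in>{0<..1}. \<forall>e\<in>{0<..e0}. P e)"

definition gauge :: "net \<Rightarrow> bool" where
  "gauge \<rho> \<longleftrightarrow> (\<forall>e\<in>{0<..1}. \<rho> e \<in> {0<..1}) \<and> (\<rho> \<longlongrightarrow> 0) (at_right 0)"

definition moderate :: "net \<Rightarrow> net set" where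
  "moderate \<rho> = {x. \<exists>N::nat. \<forall>\<^sup>0 e. \<bar>x e\<bar> \<le> \<rho> e powi (- int N)}"

definition sim :: "net \<Rightarrow> net \<Rightarrow> net \<Rightarrow> bool" where
  "sim \<rho> x y \<longleftrightarrow> (\<forall>n::nat. \<forall>\<^sup>0 e. \<bar>x e - y e\<bar> \<le> \<rho> e ^ n)"

definition negligible :: "net \<Rightarrow> net \<Rightarrow> bool" where
  "negligible \<rho> z \<longleftrightarrow> sim \<rho> z (\<lambda>_. 0)"

definition sim_rel :: "net \<Rightarrow> (net \<times> net) set" where
  "sim_rel \<rho> = {(x, y). x \<in> moderate \<rho> \<and> y \<in> moderate \<rho> \<and> sim \<rho> x y}"

definition cls :: "net \<Rightarrow> net \<Rightarrow> net set" where
  "cls \<rho> x = sim_rel \<rho> `` {x}"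

text \<open>
  The ring \<open>\<^sup>\<rho>R~\<close>. An operation on classes is the union of the classes obtained from all
  representatives, which is a single class because the operation respects \<^const>\<open>sim_rel\<close>
  (see \<open>GR_add_cls\<close>, \<open>GR_mult_cls\<close> and \<open>gabs_cls\<close> below).
\<close>

definition GR :: "net \<Rightarrow> net set ring" where
  "GR \<rho> = \<lparr>
     carrier = moderate \<rho> // sim_rel \<rho>,
     mult = (\<lambda>X Y. \<Union>x\<in>X. \<Union>y\<in>Y. cls \<rho> (\<lambda>e. x e * y e)),
     one = cls \<rho> (\<lambda>_. 1),
     zero = cls \<rho> (\<lambda>_. 0),
     add = (\<lambda>X Y. \<Union>x\<in>X. \<Union>y\<in>Y. cls \<rho> (\<lambda>e. x e + y e))\<rparr>"

definition gabs :: "net \<Rightarrow> net set \<Rightarrow> net set" where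
  "gabs \<rho> X = (\<Union>x\<in>X. cls \<rho> (\<lambda>e. \<bar>x e\<bar>))"

definition gle :: "net \<Rightarrow> net set \<Rightarrow> net set \<Rightarrow> bool" where
  "gle \<rho> X Y \<longleftrightarrow>
     (\<exists>x\<in>X. \<exists>y\<in>Y. \<exists>z. negligible \<rho> z \<and> (\<forall>\<^sup>0 e. x e \<le> y e + z e))"

definition gless :: "net \<Rightarrow> net set \<Rightarrow> net set \<Rightarrow> bool" where
  "gless \<rho> X Y \<longleftrightarrow> gle \<rho> X Y \<and> Y \<ominus>\<^bsub>GR \<rho>\<^esub> X \<in> Units (GR \<rho>)"

definition hypernat :: "net \<Rightarrow> net set set" where
  "hypernat \<sigma> = {X \<in> carrier (GR \<sigma>). \<exists>n\<in>X. \<forall>e\<in>{0<..1}. n e \<in> \<nat>}"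

definition hypernat_ge :: "net \<Rightarrow> net set \<Rightarrow> net set set" where
  "hypernat_ge \<sigma> M = {n \<in> hypernat \<sigma>. gle \<sigma> M n}"

definition hypersequence :: "net \<Rightarrow> net \<Rightarrow> (net set \<Rightarrow> net set) \<Rightarrow> bool" where
  "hypersequence \<rho> \<sigma> x \<longleftrightarrow> x \<in> hypernat \<sigma> \<rightarrow> carrier (GR \<rho>)"

definition hyperlimit :: "net \<Rightarrow> net \<Rightarrow> (net set \<Rightarrow> net set) \<Rightarrow> net set \<Rightarrow> bool" where
  "hyperlimit \<rho> \<sigma> x l \<longleftrightarrow>
     (\<forall>q::nat. \<exists>M\<in>hypernat \<sigma>. \<forall>n\<in>hypernat_ge \<sigma> M.
        gless \<rho> (gabs \<rho> (x n \<ominus>\<^bsub>GR \<rho>\<^esub> l)) (cls \<rho> \<rho> [^]\<^bsub>GR \<rho>\<^esub> q))"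

definition hyperconvergent :: "net \<Rightarrow> net \<Rightarrow> (net set \<Rightarrow> net set) \<Rightarrow> bool" where
  "hyperconvergent \<rho> \<sigma> x \<longleftrightarrow> (\<exists>l\<in>carrier (GR \<rho>). hyperlimit \<rho> \<sigma> x l)"

definition hyperCauchy :: "net \<Rightarrow> net \<Rightarrow> (net set \<Rightarrow> net set) \<Rightarrow> bool" where
  "hyperCauchy \<rho> \<sigma> x \<longleftrightarrow>
     (\<forall>q::nat. \<exists>M\<in>hypernat \<sigma>. \<forall>n\<in>hypernat_ge \<sigma> M. \<forall>m\<in>hypernat_ge \<sigma> M.
        gless \<rho> (gabs \<rho> (x n \<ominus>\<^bsub>GR \<rho>\<^esub> x m)) (cls \<rho> \<rho> [^]\<^bsub>GR \<rho>\<^esub> q))"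


lemma small_iff_eventually: "small P \<longleftrightarrow> eventually P (at_right 0)"
proof
  assume "small P"
  then obtain e0 where "0 < e0" "\<forall>e\<in>{0<..e0}. P e"
    by (auto simp: small_def)
  then show "eventually P (at_right 0)"
    by (auto simp: eventually_at_right_field intro!: exI[of _ e0])
next
  assume "eventually P (at_right 0)"
  then obtain b where b: "b > 0" "\<And>e. 0 < e \<Longrightarrow> e < b \<Longrightarrow> P e"
    by (auto simp: eventually_at_right_field)
  then show "small P"
    unfolding small_def by (intro bexI[of _ "min 1 (b/2)"]) auto
qed

lemma gauge_eventually:
  assumes "gauge \<rho>" shows "\<forall>\<^sub>F e in at_right 0. 0 < \<rho> e \<and> \<rho> e \<le> 1/2"
proof -
  have "\<forall>\<^sub>F e in at_right 0. \<rho> e < 1/2"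
    using assms unfolding gauge_def by (intro order_tendstoD(2)[of \<rho> 0]) auto
  moreover have "\<forall>\<^sub>F e in at_right (0::real). e \<in> {0<..1}"
    by (auto simp: eventually_at_right_field intro!: exI[of _ 1])
  ultimately show ?thesis
    by eventually_elim (use assms in \<open>auto simp: gauge_def\<close>)
qed

lemma moderate_iff:
  "x \<in> moderate \<rho> \<longleftrightarrow> (\<exists>N::nat. \<forall>\<^sub>F e in at_right 0. \<bar>x e\<bar> \<le> inverse (\<rho> e) ^ N)"
  by (simp add: moderate_def small_iff_eventually power_int_minus power_inverse)

lemma negligible_iff:
  "negligible \<rho> x \<longleftrightarrow> (\<forall>n::nat. \<forall>\<^sub>F e in at_right 0. \<bar>x e\<bar> \<le> \<rho> e ^ n)"
  by (simp add: negligible_def sim_def small_iff_eventually)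

lemma sim_iff: "sim \<rho> x y \<longleftrightarrow> negligible \<rho> (\<lambda>e. x e - y e)"
  by (simp add: negligible_def sim_def)

lemma moderate_mono:
  assumes "\<forall>\<^sub>F e in at_right 0. \<bar>x e\<bar> \<le> \<bar>y e\<bar>" "y \<in> moderate \<rho>"
  shows "x \<in> moderate \<rho>"
proof -
  obtain N where "\<forall>\<^sub>F e in at_right 0. \<bar>y e\<bar> \<le> inverse (\<rho> e) ^ N"
    using assms(2) moderate_iff by blast
  with assms(1) have "\<forall>\<^sub>F e in at_right 0. \<bar>x e\<bar> \<le> inverse (\<rho> e) ^ N"
    by eventually_elim auto
  then show ?thesis using moderate_iff by blast
qed

lemma negligible_mono:
  assumes "\<forall>\<^sub>F e in at_right 0. \<bar>x e\<bar> \<le> \<bar>y e\<bar>" "negligible \<rho> y"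
  shows "negligible \<rho> x"
  unfolding negligible_iff
proof
  fix n
  have "\<forall>\<^sub>F e in at_right 0. \<bar>y e\<bar> \<le> \<rho> e ^ n"
    using assms(2) by (simp add: negligible_iff)
  with assms(1) show "\<forall>\<^sub>F e in at_right 0. \<bar>x e\<bar> \<le> \<rho> e ^ n"
    by eventually_elim auto
qed

context
  fixes \<rho> :: net
  assumes g: "gauge \<rho>"
begin

lemma moderate_add:
  assumes "x \<in> moderate \<rho>" "y \<in> moderate \<rho>"
  shows "(\<lambda>e. x e + y e) \<in> moderate \<rho>"
proof -
  obtain N M where
    "\<forall>\<^sub>F e in at_right 0. \<bar>x e\<bar> \<le> inverse (\<rho> e) ^ N"
    "\<forall>\<^sub>F e in at_right 0. \<bar>y e\<bar> \<le> inverse (\<rho> e) ^ M"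
    using assms moderate_iff by blast
  with gauge_eventually[OF g]
  have "\<forall>\<^sub>F e in at_right 0. \<bar>x e + y e\<bar> \<le> inverse (\<rho> e) ^ Suc (N + M)"
  proof eventually_elim
    case (elim e)
    have 2: "2 \<le> inverse (\<rho> e)"
      using elim(1) by (simp add: field_simps)
    have "inverse (\<rho> e) ^ N \<le> inverse (\<rho> e) ^ (N + M)"
      "inverse (\<rho> e) ^ M \<le> inverse (\<rho> e) ^ (N + M)"
      using 2 by (auto intro!: power_increasing)
    then have "\<bar>x e + y e\<bar> \<le> 2 * inverse (\<rho> e) ^ (N + M)"
      using elim by linarith
    also have "\<dots> \<le> inverse (\<rho> e) * inverse (\<rho> e) ^ (N + M)"
      using 2 elim(1) by (intro mult_right_mono) auto
    finally show ?case by simp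
  qed
  then show ?thesis using moderate_iff by blast
qed

lemma moderate_mult:
  assumes "x \<in> moderate \<rho>" "y \<in> moderate \<rho>"
  shows "(\<lambda>e. x e * y e) \<in> moderate \<rho>"
proof -
  obtain N M where
    "\<forall>\<^sub>F e in at_right 0. \<bar>x e\<bar> \<le> inverse (\<rho> e) ^ N"
    "\<forall>\<^sub>F e in at_right 0. \<bar>y e\<bar> \<le> inverse (\<rho> e) ^ M"
    using assms moderate_iff by blast
  then have "\<forall>\<^sub>F e in at_right 0. \<bar>x e * y e\<bar> \<le> inverse (\<rho> e) ^ (N + M)"
  proof eventually_elim
    case (elim e)
    have "0 \<le> inverse (\<rho> e) ^ N" using elim(1) by linarith
    then show ?case
      unfolding abs_mult power_add using elim by (intro mult_mono) auto
  qed
  then show ?thesis using moderate_iff by blast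
qed

lemma moderate_uminus: "x \<in> moderate \<rho> \<Longrightarrow> (\<lambda>e. - x e) \<in> moderate \<rho>"
  by (rule moderate_mono[of _ x]) auto

lemma moderate_diff:
  "x \<in> moderate \<rho> \<Longrightarrow> y \<in> moderate \<rho> \<Longrightarrow> (\<lambda>e. x e - y e) \<in> moderate \<rho>"
  using moderate_add[of x "\<lambda>e. - y e"] moderate_uminus by simp

lemma moderate_abs: "x \<in> moderate \<rho> \<Longrightarrow> (\<lambda>e. \<bar>x e\<bar>) \<in> moderate \<rho>"
  by (rule moderate_mono[of _ x]) auto

lemma moderate_1: "(\<lambda>_. 1) \<in> moderate \<rho>"
  unfolding moderate_iff by (intro exI[of _ 0]) simp

lemma moderate_0: "(\<lambda>_. 0) \<in> moderate \<rho>"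
  by (rule moderate_mono[OF _ moderate_1]) simp

lemma moderate_gauge: "\<rho> \<in> moderate \<rho>"
  by (rule moderate_mono[OF _ moderate_1])
     (rule eventually_mono[OF gauge_eventually[OF g]], auto)

lemma moderate_power: "x \<in> moderate \<rho> \<Longrightarrow> (\<lambda>e. x e ^ n) \<in> moderate \<rho>" for n :: nat
  by (induction n) (auto intro: moderate_1 moderate_mult)

lemma negligible_0: "negligible \<rho> (\<lambda>_. 0)"
  unfolding negligible_iff
  by (intro allI eventually_mono[OF gauge_eventually[OF g]]) auto

lemma negligible_add:
  assumes "negligible \<rho> x" "negligible \<rho> y"
  shows "negligible \<rho> (\<lambda>e. x e + y e)"
  unfolding negligible_iff
proof
  fix n
  have "\<forall>\<^sub>F e in at_right 0. \<bar>x e\<bar> \<le> \<rho> e ^ Suc n" "\<forall>\<^sub>F e in at_right 0. \<bar>y e\<bar> \<le> \<rho> e ^ Suc n"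
    using assms unfolding negligible_iff by blast+
  with gauge_eventually[OF g]
  show "\<forall>\<^sub>F e in at_right 0. \<bar>x e + y e\<bar> \<le> \<rho> e ^ n"
  proof eventually_elim
    case (elim e)
    have "\<bar>x e + y e\<bar> \<le> (2 * \<rho> e) * \<rho> e ^ n"
      using elim by auto
    also have "\<dots> \<le> 1 * \<rho> e ^ n"
      using elim by (intro mult_right_mono) auto
    finally show ?case by simp
  qed
qed

lemma negligible_uminus: "negligible \<rho> x \<Longrightarrow> negligible \<rho> (\<lambda>e. - x e)"
  by (rule negligible_mono[of _ x]) auto

lemma negligible_mult:
  assumes "x \<in> moderate \<rho>" "negligible \<rho> y"
  shows "negligible \<rho> (\<lambda>e. x e * y e)"
  unfolding negligible_iff
proof
  fix n
  obtain N where "\<forall>\<^sub>F e in at_right 0. \<bar>x e\<bar> \<le> inverse (\<rho> e) ^ N"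
    using assms(1) moderate_iff by blast
  moreover have "\<forall>\<^sub>F e in at_right 0. \<bar>y e\<bar> \<le> \<rho> e ^ (N + n)"
    using assms(2) unfolding negligible_iff by blast
  ultimately show "\<forall>\<^sub>F e in at_right 0. \<bar>x e * y e\<bar> \<le> \<rho> e ^ n"
    using gauge_eventually[OF g]
  proof eventually_elim
    case (elim e)
    have "\<bar>x e * y e\<bar> \<le> inverse (\<rho> e) ^ N * \<rho> e ^ (N + n)"
      unfolding abs_mult using elim by (intro mult_mono) auto
    also have "\<dots> = \<rho> e ^ n"
      using elim by (simp add: power_add field_simps)
    finally show ?case .
  qed
qed

lemma sim_refl: "sim \<rho> x x"
  by (simp add: sim_iff negligible_0)

lemma sim_sym: "sim \<rho> x y \<Longrightarrow> sim \<rho> y x"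
  by (simp add: sim_def abs_minus_commute)

lemma sim_trans: "sim \<rho> x y \<Longrightarrow> sim \<rho> y z \<Longrightarrow> sim \<rho> x z"
  unfolding sim_iff by (drule (1) negligible_add) simp

lemma sim_add: "sim \<rho> x x' \<Longrightarrow> sim \<rho> y y' \<Longrightarrow> sim \<rho> (\<lambda>e. x e + y e) (\<lambda>e. x' e + y' e)"
  unfolding sim_iff by (drule (1) negligible_add) (simp add: algebra_simps)

lemma sim_abs: "sim \<rho> x x' \<Longrightarrow> sim \<rho> (\<lambda>e. \<bar>x e\<bar>) (\<lambda>e. \<bar>x' e\<bar>)"
  unfolding sim_iff by (erule negligible_mono[rotated], intro always_eventually allI, linarith)

lemma sim_mult:
  assumes "sim \<rho> x x'" "sim \<rho> y y'" "x \<in> moderate \<rho>" "y' \<in> moderate \<rho>"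
  shows "sim \<rho> (\<lambda>e. x e * y e) (\<lambda>e. x' e * y' e)"
  using negligible_add[OF negligible_mult[OF assms(3) assms(2)[unfolded sim_iff]]
      negligible_mult[OF assms(4) assms(1)[unfolded sim_iff]]]
  unfolding sim_iff by (simp add: algebra_simps)

lemma equiv_sim_rel: "equiv (moderate \<rho>) (sim_rel \<rho>)"
  by (rule equivI)
     (auto simp: sim_rel_def refl_on_def sym_def trans_def intro: sim_refl sim_sym sim_trans)

lemma mem_cls_iff: "y \<in> cls \<rho> x \<longleftrightarrow> x \<in> moderate \<rho> \<and> y \<in> moderate \<rho> \<and> sim \<rho> x y"
  by (simp add: cls_def sim_rel_def)

lemma cls_eq_iff:
  "x \<in> moderate \<rho> \<Longrightarrow> y \<in> moderate \<rho> \<Longrightarrow> cls \<rho> x = cls \<rho> y \<longleftrightarrow> sim \<rho> x y"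
  unfolding cls_def using eq_equiv_class_iff[OF equiv_sim_rel]
  by (simp add: sim_rel_def)

lemma cls_self: "x \<in> moderate \<rho> \<Longrightarrow> x \<in> cls \<rho> x"
  by (simp add: mem_cls_iff sim_refl)

lemma cls_closed: "x \<in> moderate \<rho> \<Longrightarrow> cls \<rho> x \<in> carrier (GR \<rho>)"
  by (simp add: GR_def cls_def quotientI)

lemma GR_cases:
  assumes "X \<in> carrier (GR \<rho>)"
  obtains x where "x \<in> moderate \<rho>" "X = cls \<rho> x"
  using assms by (auto simp: GR_def cls_def elim: quotientE)

lemma UN_cls_eq:
  assumes "x \<in> moderate \<rho>"
    and "\<And>x'. x' \<in> moderate \<rho> \<Longrightarrow> sim \<rho> x x' \<Longrightarrow> F x' = C"
  shows "(\<Union>x'\<in>cls \<rho> x. F x') = C"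
proof -
  have "F x' = C" if "x' \<in> cls \<rho> x" for x'
    using that assms by (auto simp: mem_cls_iff)
  then show ?thesis using cls_self[OF assms(1)] by auto
qed

lemma GR_add_cls:
  assumes "x \<in> moderate \<rho>" "y \<in> moderate \<rho>"
  shows "cls \<rho> x \<oplus>\<^bsub>GR \<rho>\<^esub> cls \<rho> y = cls \<rho> (\<lambda>e. x e + y e)"
  unfolding GR_def ring.simps
  by (intro UN_cls_eq assms cls_eq_iff[THEN iffD2] moderate_add sim_sym[OF sim_add])

lemma GR_mult_cls:
  assumes "x \<in> moderate \<rho>" "y \<in> moderate \<rho>"
  shows "cls \<rho> x \<otimes>\<^bsub>GR \<rho>\<^esub> cls \<rho> y = cls \<rho> (\<lambda>e. x e * y e)"
  unfolding GR_def monoid.simps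
  by (intro UN_cls_eq assms cls_eq_iff[THEN iffD2] moderate_mult sim_sym[OF sim_mult])

lemma gabs_cls:
  assumes "x \<in> moderate \<rho>"
  shows "gabs \<rho> (cls \<rho> x) = cls \<rho> (\<lambda>e. \<bar>x e\<bar>)"
  unfolding gabs_def
  by (intro UN_cls_eq assms cls_eq_iff[THEN iffD2] moderate_abs sim_sym[OF sim_abs])

lemma GR_one: "\<one>\<^bsub>GR \<rho>\<^esub> = cls \<rho> (\<lambda>_. 1)"
  by (simp add: GR_def)

lemma GR_zero: "\<zero>\<^bsub>GR \<rho>\<^esub> = cls \<rho> (\<lambda>_. 0)"
  by (simp add: GR_def)

lemmas GR_cls_simps = GR_add_cls GR_mult_cls GR_one GR_zero
lemmas moderate_intros = moderate_add moderate_mult moderate_uminus moderate_diff moderate_abs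
  moderate_0 moderate_1 moderate_power moderate_gauge

lemma cring_GR: "cring (GR \<rho>)"
proof (rule cringI)
  show "abelian_group (GR \<rho>)"
  proof (rule abelian_groupI)
    fix X assume "X \<in> carrier (GR \<rho>)"
    then obtain x where x: "x \<in> moderate \<rho>" "X = cls \<rho> x" by (rule GR_cases)
    show "\<exists>Y\<in>carrier (GR \<rho>). Y \<oplus>\<^bsub>GR \<rho>\<^esub> X = \<zero>\<^bsub>GR \<rho>\<^esub>"
      using x by (intro bexI[of _ "cls \<rho> (\<lambda>e. - x e)"])
        (auto simp: GR_cls_simps moderate_intros cls_closed)
  qed (auto elim!: GR_cases simp: GR_cls_simps moderate_intros cls_closed algebra_simps)
  show "Group.comm_monoid (GR \<rho>)"
    by (rule comm_monoidI)
       (auto elim!: GR_cases simp: GR_cls_simps moderate_intros cls_closed algebra_simps)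
qed (auto elim!: GR_cases simp: GR_cls_simps moderate_intros cls_closed algebra_simps)

lemma GR_minus_cls:
  assumes "x \<in> moderate \<rho>" "y \<in> moderate \<rho>"
  shows "cls \<rho> x \<ominus>\<^bsub>GR \<rho>\<^esub> cls \<rho> y = cls \<rho> (\<lambda>e. x e - y e)"
proof -
  interpret cring "GR \<rho>" by (rule cring_GR)
  have "\<ominus>\<^bsub>GR \<rho>\<^esub> cls \<rho> y = cls \<rho> (\<lambda>e. - y e)"
    by (rule minus_equality) (use assms in \<open>simp_all add: GR_cls_simps moderate_intros cls_closed\<close>)
  then show ?thesis
    using assms by (simp add: a_minus_def GR_cls_simps moderate_intros)
qed

lemma GR_pow_cls:
  assumes "x \<in> moderate \<rho>"
  shows "cls \<rho> x [^]\<^bsub>GR \<rho>\<^esub> (n::nat) = cls \<rho> (\<lambda>e. x e ^ n)"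
proof -
  interpret cring "GR \<rho>" by (rule cring_GR)
  show ?thesis
    using assms by (induction n) (simp_all add: GR_cls_simps moderate_intros mult.commute)
qed

lemma gle_cls_iff:
  assumes "x \<in> moderate \<rho>" "y \<in> moderate \<rho>"
  shows "gle \<rho> (cls \<rho> x) (cls \<rho> y) \<longleftrightarrow>
    (\<exists>z. negligible \<rho> z \<and> (\<forall>\<^sup>0 e. x e \<le> y e + z e))"
proof
  assume "gle \<rho> (cls \<rho> x) (cls \<rho> y)"
  then obtain x' y' z where *: "sim \<rho> x x'" "sim \<rho> y y'" "negligible \<rho> z"
    and le: "\<forall>\<^sup>0 e. x' e \<le> y' e + z e"
    by (auto simp: gle_def mem_cls_iff)
  have "negligible \<rho> (\<lambda>e. (x e - x' e) + ((y' e - y e) + z e))"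
    using * sim_sym by (intro negligible_add) (auto simp: sim_iff)
  moreover have "\<forall>\<^sup>0 e. x e \<le> y e + ((x e - x' e) + ((y' e - y e) + z e))"
    using le unfolding small_iff_eventually by eventually_elim auto
  ultimately show "\<exists>z. negligible \<rho> z \<and> (\<forall>\<^sup>0 e. x e \<le> y e + z e)" by blast
qed (use assms cls_self in \<open>auto simp: gle_def\<close>)

end

end

(*
  Up to a shift of the exponent q, the relation |[x] - [y]| < d rho^q says that |x e - y e| <= rho e ^ q
  for all small e.  A Cauchy hypersequence with moduli M_k therefore yields an ordinary sequence of
  representatives a_k of x (M_k + M_(k+1)) with |a_k - a_(k+1)| <= rho^k eventually.  Choosing for each e
  the largest index k <= 1/e up to which all these estimates hold at e, the diagonal net a_(k(e)) e
  represents the hyperlimit: the tails are dominated by a geometric series.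
*)
theory Submission
  imports Defs
begin

section \<open>The order of the quotient ring in terms of eventual estimates\<close>

text \<open>The pointwise inverse is eventually at most \<open>inverse (\<rho> e) ^ n\<close>, hence
  moderate. This supplies the invertibility that \<open>gless\<close> demands besides
  \<open>gle\<close>.\<close>

lemma GR_unit_cls:
  assumes g: "gauge \<rho>" and x: "x \<in> moderate \<rho>"
    and lb: "\<forall>\<^sub>F e in at_right 0. \<rho> e ^ n \<le> x e"
  shows "cls \<rho> x \<in> Units (GR \<rho>)"
proof -
  interpret cring "GR \<rho>" by (rule cring_GR[OF g])
  have "(\<lambda>e. inverse (x e)) \<in> moderate \<rho>"
    unfolding moderate_iff
  proof
    show "\<forall>\<^sub>F e in at_right 0. \<bar>inverse (x e)\<bar> \<le> inverse (\<rho> e) ^ n"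
      using gauge_eventually[OF g] lb
    proof eventually_elim
      case (elim e)
      then have "0 < \<rho> e ^ n" by simp
      with elim have "0 < x e" "inverse (x e) \<le> inverse (\<rho> e ^ n)"
        by (linarith, intro le_imp_inverse_le) auto
      then show ?case
        by (simp add: power_inverse)
    qed
  qed
  \<comment> \<open>Where \<open>x e = 0\<close> the product is 0, not 1. The lower bound excludes
    this for small \<open>e\<close>, so the error is eventually 0 and thus negligible.\<close>
  moreover have "sim \<rho> (\<lambda>e. x e * inverse (x e)) (\<lambda>_. 1)"
    unfolding sim_iff
  proof (rule negligible_mono[OF _ negligible_0[OF g]])
    show "\<forall>\<^sub>F e in at_right 0. \<bar>x e * inverse (x e) - 1\<bar> \<le> \<bar>0\<bar>"
      using gauge_eventually[OF g] lb
    proof eventually_elim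
      case (elim e)
      then have "0 < \<rho> e ^ n" by simp
      with elim have "x e \<noteq> 0" by linarith
      then show ?case by simp
    qed
  qed
  ultimately have "cls \<rho> x \<otimes>\<^bsub>GR \<rho>\<^esub> cls \<rho> (\<lambda>e. inverse (x e)) = \<one>\<^bsub>GR \<rho>\<^esub>"
    and "cls \<rho> (\<lambda>e. inverse (x e)) \<in> carrier (GR \<rho>)"
    by (simp_all add: GR_cls_simps[OF g] cls_eq_iff[OF g] moderate_intros[OF g] cls_closed[OF g] x)
  moreover have "cls \<rho> x \<in> carrier (GR \<rho>)"
    using cls_closed[OF g] x .
  ultimately show ?thesis
    by (simp add: Units_def) (metis m_comm)
qed

text \<open>One exponent is lost to the negligible net hidden in \<open>gle\<close>: it is at most
  \<open>\<rho> e ^ Suc q\<close> eventually, and the sum of two such terms is at most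
  \<open>\<rho> e ^ q\<close> because \<open>\<rho> e \<le> 1/2\<close>.\<close>

lemma gless_dist_imp_eventually:
  assumes g: "gauge \<rho>" and x: "x \<in> moderate \<rho>" and y: "y \<in> moderate \<rho>"
    and less: "gless \<rho> (gabs \<rho> (cls \<rho> x \<ominus>\<^bsub>GR \<rho>\<^esub> cls \<rho> y)) (cls \<rho> \<rho> [^]\<^bsub>GR \<rho>\<^esub> Suc q)"
  shows "\<forall>\<^sub>F e in at_right 0. \<bar>x e - y e\<bar> \<le> \<rho> e ^ q"
proof -
  have "gle \<rho> (cls \<rho> (\<lambda>e. \<bar>x e - y e\<bar>)) (cls \<rho> (\<lambda>e. \<rho> e ^ Suc q))"
    using less x y by (simp only: gless_def GR_minus_cls[OF g] gabs_cls[OF g] GR_pow_cls[OF g]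
        moderate_intros[OF g])
  then obtain z where z: "negligible \<rho> z" "\<forall>\<^sub>F e in at_right 0. \<bar>x e - y e\<bar> \<le> \<rho> e ^ Suc q + z e"
    using x y by (auto simp: gle_cls_iff[OF g] moderate_intros[OF g] small_iff_eventually
        simp del: power_Suc)
  from z(1) have "\<forall>\<^sub>F e in at_right 0. \<bar>z e\<bar> \<le> \<rho> e ^ Suc q"
    unfolding negligible_iff by blast
  with z(2) gauge_eventually[OF g] show ?thesis
  proof eventually_elim
    case (elim e)
    then have "\<bar>x e - y e\<bar> \<le> (2 * \<rho> e) * \<rho> e ^ q" by auto
    also have "\<dots> \<le> 1 * \<rho> e ^ q"
      using elim by (intro mult_right_mono) auto
    finally show ?case by simp
  qed
qed

text \<open>The surplus exponent leaves a gap: since \<open>2 * \<rho> e \<le> 1\<close>, the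
  difference \<open>\<rho> e ^ q - \<bar>x e - y e\<bar>\<close> is at least
  \<open>\<rho> e ^ Suc q\<close>, which makes its class a unit.\<close>

lemma eventually_imp_gless_dist:
  assumes g: "gauge \<rho>" and x: "x \<in> moderate \<rho>" and y: "y \<in> moderate \<rho>"
    and le: "\<forall>\<^sub>F e in at_right 0. \<bar>x e - y e\<bar> \<le> \<rho> e ^ Suc q"
  shows "gless \<rho> (gabs \<rho> (cls \<rho> x \<ominus>\<^bsub>GR \<rho>\<^esub> cls \<rho> y)) (cls \<rho> \<rho> [^]\<^bsub>GR \<rho>\<^esub> q)"
proof -
  have lb: "\<forall>\<^sub>F e in at_right 0. \<rho> e ^ Suc q \<le> \<rho> e ^ q - \<bar>x e - y e\<bar>"
    using le gauge_eventually[OF g]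
  proof eventually_elim
    case (elim e)
    have "(2 * \<rho> e) * \<rho> e ^ q \<le> 1 * \<rho> e ^ q"
      using elim by (intro mult_right_mono) auto
    with elim show ?case unfolding power_Suc by linarith
  qed
  have "\<forall>\<^sub>F e in at_right 0. \<bar>x e - y e\<bar> \<le> \<rho> e ^ q + 0"
    using lb gauge_eventually[OF g]
  proof eventually_elim
    case (elim e)
    then have "0 < \<rho> e ^ Suc q" by simp
    with elim show ?case by linarith
  qed
  then have "gle \<rho> (cls \<rho> (\<lambda>e. \<bar>x e - y e\<bar>)) (cls \<rho> (\<lambda>e. \<rho> e ^ q))"
    using x y negligible_0[OF g]
    by (auto simp: gle_cls_iff[OF g] moderate_intros[OF g] small_iff_eventually)
  moreover have "cls \<rho> (\<lambda>e. \<rho> e ^ q - \<bar>x e - y e\<bar>) \<in> Units (GR \<rho>)"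
    by (rule GR_unit_cls[OF g _ lb]) (simp add: moderate_intros[OF g] x y)
  ultimately show ?thesis
    using x y by (simp add: gless_def GR_minus_cls[OF g] gabs_cls[OF g] GR_pow_cls[OF g]
        moderate_intros[OF g])
qed

section \<open>Hyperlimits and Cauchy hypersequences on representatives\<close>

text \<open>The exponent shifts of the two preceding lemmas are absorbed by the quantifier over
  \<open>q\<close>. The index \<open>M\<close> is uniform in \<open>n\<close>, while the threshold
  for \<open>e\<close> may depend on \<open>n\<close>.\<close>

lemma hyperlimit_iff:
  assumes g: "gauge \<rho>" and l: "l \<in> moderate \<rho>"
    and r: "\<And>n. n \<in> hypernat \<sigma> \<Longrightarrow> r n \<in> moderate \<rho> \<and> x n = cls \<rho> (r n)"
  shows "hyperlimit \<rho> \<sigma> x (cls \<rho> l) \<longleftrightarrow>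
    (\<forall>q. \<exists>M\<in>hypernat \<sigma>. \<forall>n\<in>hypernat_ge \<sigma> M. \<forall>\<^sub>F e in at_right 0. \<bar>r n e - l e\<bar> \<le> \<rho> e ^ q)"
    (is "_ \<longleftrightarrow> ?R")
proof
  assume L: "hyperlimit \<rho> \<sigma> x (cls \<rho> l)"
  show ?R
  proof
    fix q
    from L obtain M where M: "M \<in> hypernat \<sigma>" "\<forall>n\<in>hypernat_ge \<sigma> M.
        gless \<rho> (gabs \<rho> (x n \<ominus>\<^bsub>GR \<rho>\<^esub> cls \<rho> l)) (cls \<rho> \<rho> [^]\<^bsub>GR \<rho>\<^esub> Suc q)"
      unfolding hyperlimit_def by blast
    have "\<forall>n\<in>hypernat_ge \<sigma> M. \<forall>\<^sub>F e in at_right 0. \<bar>r n e - l e\<bar> \<le> \<rho> e ^ q"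
      using M(2) r l unfolding hypernat_ge_def
      by (intro ballI gless_dist_imp_eventually[OF g]) auto
    with M(1) show "\<exists>M\<in>hypernat \<sigma>. \<forall>n\<in>hypernat_ge \<sigma> M.
        \<forall>\<^sub>F e in at_right 0. \<bar>r n e - l e\<bar> \<le> \<rho> e ^ q"
      by blast
  qed
next
  assume R: ?R
  show "hyperlimit \<rho> \<sigma> x (cls \<rho> l)"
    unfolding hyperlimit_def
  proof
    fix q
    from R obtain M where M: "M \<in> hypernat \<sigma>"
      "\<forall>n\<in>hypernat_ge \<sigma> M. \<forall>\<^sub>F e in at_right 0. \<bar>r n e - l e\<bar> \<le> \<rho> e ^ Suc q"
      by blast
    have "gless \<rho> (gabs \<rho> (x n \<ominus>\<^bsub>GR \<rho>\<^esub> cls \<rho> l)) (cls \<rho> \<rho> [^]\<^bsub>GR \<rho>\<^esub> q)"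
      if n: "n \<in> hypernat_ge \<sigma> M" for n
    proof -
      have "r n \<in> moderate \<rho>" "x n = cls \<rho> (r n)"
        using r n unfolding hypernat_ge_def by auto
      then show ?thesis
        using eventually_imp_gless_dist[OF g _ l] M(2) n by simp
    qed
    with M(1) show "\<exists>M\<in>hypernat \<sigma>. \<forall>n\<in>hypernat_ge \<sigma> M.
        gless \<rho> (gabs \<rho> (x n \<ominus>\<^bsub>GR \<rho>\<^esub> cls \<rho> l)) (cls \<rho> \<rho> [^]\<^bsub>GR \<rho>\<^esub> q)"
      by blast
  qed
qed

lemma hyperCauchy_iff:
  assumes g: "gauge \<rho>"
    and r: "\<And>n. n \<in> hypernat \<sigma> \<Longrightarrow> r n \<in> moderate \<rho> \<and> x n = cls \<rho> (r n)"
  shows "hyperCauchy \<rho> \<sigma> x \<longleftrightarrow>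
    (\<forall>q. \<exists>M\<in>hypernat \<sigma>. \<forall>n\<in>hypernat_ge \<sigma> M. \<forall>m\<in>hypernat_ge \<sigma> M.
      \<forall>\<^sub>F e in at_right 0. \<bar>r n e - r m e\<bar> \<le> \<rho> e ^ q)"
    (is "_ \<longleftrightarrow> ?R")
proof
  assume L: "hyperCauchy \<rho> \<sigma> x"
  show ?R
  proof
    fix q
    from L obtain M where M: "M \<in> hypernat \<sigma>"
      "\<forall>n\<in>hypernat_ge \<sigma> M. \<forall>m\<in>hypernat_ge \<sigma> M.
        gless \<rho> (gabs \<rho> (x n \<ominus>\<^bsub>GR \<rho>\<^esub> x m)) (cls \<rho> \<rho> [^]\<^bsub>GR \<rho>\<^esub> Suc q)"
      unfolding hyperCauchy_def by blast
    have "\<forall>n\<in>hypernat_ge \<sigma> M. \<forall>m\<in>hypernat_ge \<sigma> M.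
        \<forall>\<^sub>F e in at_right 0. \<bar>r n e - r m e\<bar> \<le> \<rho> e ^ q"
      using M(2) r unfolding hypernat_ge_def
      by (intro ballI gless_dist_imp_eventually[OF g]) auto
    with M(1) show "\<exists>M\<in>hypernat \<sigma>. \<forall>n\<in>hypernat_ge \<sigma> M. \<forall>m\<in>hypernat_ge \<sigma> M.
        \<forall>\<^sub>F e in at_right 0. \<bar>r n e - r m e\<bar> \<le> \<rho> e ^ q"
      by blast
  qed
next
  assume R: ?R
  show "hyperCauchy \<rho> \<sigma> x"
    unfolding hyperCauchy_def
  proof
    fix q
    from R obtain M where M: "M \<in> hypernat \<sigma>"
      "\<forall>n\<in>hypernat_ge \<sigma> M. \<forall>m\<in>hypernat_ge \<sigma> M.
        \<forall>\<^sub>F e in at_right 0. \<bar>r n e - r m e\<bar> \<le> \<rho> e ^ Suc q"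
      by blast
    have "gless \<rho> (gabs \<rho> (x n \<ominus>\<^bsub>GR \<rho>\<^esub> x m)) (cls \<rho> \<rho> [^]\<^bsub>GR \<rho>\<^esub> q)"
      if nm: "n \<in> hypernat_ge \<sigma> M" "m \<in> hypernat_ge \<sigma> M" for n m
    proof -
      have "r n \<in> moderate \<rho>" "x n = cls \<rho> (r n)" "r m \<in> moderate \<rho>" "x m = cls \<rho> (r m)"
        using r nm unfolding hypernat_ge_def by auto
      then show ?thesis
        using eventually_imp_gless_dist[OF g] M(2) nm by simp
    qed
    with M(1) show "\<exists>M\<in>hypernat \<sigma>. \<forall>n\<in>hypernat_ge \<sigma> M. \<forall>m\<in>hypernat_ge \<sigma> M.
        gless \<rho> (gabs \<rho> (x n \<ominus>\<^bsub>GR \<rho>\<^esub> x m)) (cls \<rho> \<rho> [^]\<^bsub>GR \<rho>\<^esub> q)"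
      by blast
  qed
qed

section \<open>Directedness of the hypernaturals\<close>

text \<open>The order is only partial, so neither index need dominate the other; the sum of
  nonnegative representatives dominates both.\<close>

lemma hypernat_upper_bound:
  assumes g: "gauge \<sigma>" and "M \<in> hypernat \<sigma>" "N \<in> hypernat \<sigma>"
  obtains K where "K \<in> hypernat_ge \<sigma> M" "K \<in> hypernat_ge \<sigma> N"
proof -
  \<comment> \<open>Some element of the class has natural values, but the representative from
    \<open>GR_cases\<close> need not; any element of a class represents it, so the former replaces
    the latter.\<close>
  have rep: "\<exists>m. m \<in> moderate \<sigma> \<and> L = cls \<sigma> m \<and> (\<forall>e\<in>{0<..1}. m e \<in> \<nat>)"
    if L: "L \<in> hypernat \<sigma>" for L
  proof -
    obtain a m where "a \<in> moderate \<sigma>" "L = cls \<sigma> a" "m \<in> L" "\<forall>e\<in>{0<..1}. m e \<in> \<nat>"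
      using L unfolding hypernat_def by (auto elim: GR_cases[OF g])
    then show ?thesis
      by (intro exI[of _ m]) (auto simp: mem_cls_iff[OF g] cls_eq_iff[OF g])
  qed
  obtain m n where m: "m \<in> moderate \<sigma>" "M = cls \<sigma> m" "\<forall>e\<in>{0<..1}. m e \<in> \<nat>"
    and n: "n \<in> moderate \<sigma>" "N = cls \<sigma> n" "\<forall>e\<in>{0<..1}. n e \<in> \<nat>"
    using rep[OF assms(2)] rep[OF assms(3)] by blast
  let ?k = "\<lambda>e. m e + n e"
  have k: "?k \<in> moderate \<sigma>"
    using m n by (simp add: moderate_intros[OF g])
  have "cls \<sigma> ?k \<in> hypernat \<sigma>"
    unfolding hypernat_def using k m n cls_closed[OF g k] cls_self[OF g k]
    by (auto intro!: bexI[of _ ?k])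
  moreover have "0 \<le> y" if "y \<in> \<nat>" for y :: real
    using that by (auto elim: Nats_cases)
  then have "\<forall>\<^sup>0 e. m e \<le> ?k e + 0" "\<forall>\<^sup>0 e. n e \<le> ?k e + 0"
    unfolding small_def using m(3) n(3) by (auto intro!: exI[of _ 1])
  then have "gle \<sigma> M (cls \<sigma> ?k)" "gle \<sigma> N (cls \<sigma> ?k)"
    unfolding m(2) n(2) using m(1) n(1) k gle_cls_iff[OF g] negligible_0[OF g] by blast+
  ultimately show ?thesis
    using that by (simp add: hypernat_ge_def)
qed

section \<open>Diagonal limits of sequences of moderate nets\<close>

lemma geometric_telescope:
  fixes a :: "nat \<Rightarrow> real"
  assumes "q \<le> K" "0 \<le> r" "r \<le> 1/2" "\<forall>j<K. \<bar>a j - a (Suc j)\<bar> \<le> r ^ j"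
  shows "\<bar>a q - a K\<bar> \<le> 2 * r ^ q"
proof -
  \<comment> \<open>The subtracted term makes the induction close: a step adds \<open>r ^ n\<close>,
    and \<open>2 * r ^ Suc n \<le> r ^ n\<close> pays for it.\<close>
  have "\<bar>a q - a K\<bar> \<le> 2 * r ^ q - 2 * r ^ K"
    using assms(1,4)
  proof (induction K rule: dec_induct)
    case base
    then show ?case by simp
  next
    case (step n)
    have "2 * r * r ^ n \<le> 1 * r ^ n"
      using assms by (intro mult_right_mono) auto
    moreover have "\<bar>a q - a n\<bar> \<le> 2 * r ^ q - 2 * r ^ n" "\<bar>a n - a (Suc n)\<bar> \<le> r ^ n"
      using step by simp_all
    ultimately show ?case
      by simp
  qed
  moreover have "0 \<le> r ^ K" using assms(2) by simp
  ultimately show ?thesis by linarith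
qed

lemma net_sequence_complete:
  assumes g: "gauge \<rho>"
    and a: "\<And>k. a k \<in> moderate \<rho>"
    and cauchy: "\<And>k. \<forall>\<^sub>F e in at_right 0. \<bar>a k e - a (Suc k) e\<bar> \<le> \<rho> e ^ k"
  obtains l where "l \<in> moderate \<rho>"
    and "\<And>q. \<forall>\<^sub>F e in at_right 0. \<bar>a q e - l e\<bar> \<le> 2 * \<rho> e ^ q"
proof -
  \<comment> \<open>The cap \<open>1 / e\<close> guarantees a greatest index even if all estimates
    hold at \<open>e\<close>. It tends to infinity as \<open>e\<close> tends to 0, so it eventually
    admits each fixed \<open>q\<close>.\<close>
  define P where "P e k \<longleftrightarrow> real k \<le> 1 / e \<and> (\<forall>j<k. \<bar>a j e - a (Suc j) e\<bar> \<le> \<rho> e ^ j)" for e k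
  define l where "l e = a (Greatest (P e)) e" for e
  have lim: "\<forall>\<^sub>F e in at_right 0. \<bar>a q e - l e\<bar> \<le> 2 * \<rho> e ^ q" for q
  proof -
    \<comment> \<open>Only finitely many estimates are involved, so they have a common
      threshold.\<close>
    have "\<forall>\<^sub>F e in at_right 0. \<forall>j\<in>{..<q}. \<bar>a j e - a (Suc j) e\<bar> \<le> \<rho> e ^ j"
      using cauchy by (intro eventually_ball_finite) auto
    moreover have "\<forall>\<^sub>F e in at_right 0. real q \<le> 1 / e"
      unfolding eventually_at_right_field
      by (rule exI[of _ "1 / (real q + 1)"]) (auto simp: field_simps)
    moreover have "\<forall>\<^sub>F e in at_right (0::real). 0 < e"
      by (rule eventually_at_right_less)
    ultimately show ?thesis
      using gauge_eventually[OF g]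
    proof eventually_elim
      case (elim e)
      have Pq: "P e q"
        using elim by (auto simp: P_def)
      have bound: "k \<le> nat \<lfloor>1 / e\<rfloor>" if "P e k" for k
        using that by (auto simp: P_def le_nat_floor)
      have "P e (Greatest (P e))" "q \<le> Greatest (P e)"
        using GreatestI_nat[of "P e", OF Pq] Greatest_le_nat[of "P e", OF Pq] bound by blast+
      with elim show ?case
        unfolding l_def P_def by (intro geometric_telescope) auto
    qed
  qed
  \<comment> \<open>The case \<open>q = 0\<close> of the estimate bounds this difference by 2, so
    \<open>l\<close> inherits moderateness from \<open>a 0\<close>.\<close>
  have "(\<lambda>e. l e - a 0 e) \<in> moderate \<rho>"
  proof (rule moderate_mono)
    show "\<forall>\<^sub>F e in at_right 0. \<bar>l e - a 0 e\<bar> \<le> \<bar>1 + 1\<bar>"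
      using lim[of 0] by eventually_elim (simp add: abs_minus_commute)
    show "(\<lambda>_. 1 + 1) \<in> moderate \<rho>"
      by (intro moderate_add[OF g] moderate_1[OF g])
  qed
  then have "(\<lambda>e. (l e - a 0 e) + a 0 e) \<in> moderate \<rho>"
    using a by (intro moderate_add[OF g])
  then have "l \<in> moderate \<rho>" by simp
  then show ?thesis using that lim by blast
qed

section \<open>Convergence and the Cauchy condition for hypersequences\<close>

theorem theorem46:
  fixes \<rho> \<sigma> :: net and x :: "net set \<Rightarrow> net set"
  assumes "gauge \<rho>" and "gauge \<sigma>" and "hypersequence \<rho> \<sigma> x"
  shows "hyperconvergent \<rho> \<sigma> x \<longleftrightarrow> hyperCauchy \<rho> \<sigma> x"
proof -
  note g = assms(1)
  have "\<forall>n\<in>hypernat \<sigma>. \<exists>r. r \<in> moderate \<rho> \<and> x n = cls \<rho> r"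
    using assms(3) GR_cases[OF g] unfolding hypersequence_def Pi_iff by metis
  then obtain r where r: "\<And>n. n \<in> hypernat \<sigma> \<Longrightarrow> r n \<in> moderate \<rho> \<and> x n = cls \<rho> (r n)"
    by metis
  have cauchy_iff: "hyperCauchy \<rho> \<sigma> x \<longleftrightarrow>
    (\<forall>q. \<exists>M\<in>hypernat \<sigma>. \<forall>n\<in>hypernat_ge \<sigma> M. \<forall>m\<in>hypernat_ge \<sigma> M.
      \<forall>\<^sub>F e in at_right 0. \<bar>r n e - r m e\<bar> \<le> \<rho> e ^ q)"
    by (rule hyperCauchy_iff[OF g r])
  have ge_hypernat: "n \<in> hypernat \<sigma>" if "n \<in> hypernat_ge \<sigma> M" for n M
    using that by (simp add: hypernat_ge_def)
  show ?thesis
  proof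
    assume "hyperconvergent \<rho> \<sigma> x"
    then obtain l where l: "l \<in> moderate \<rho>" and "hyperlimit \<rho> \<sigma> x (cls \<rho> l)"
      unfolding hyperconvergent_def by (blast elim: GR_cases[OF g])
    then have lim: "\<exists>M\<in>hypernat \<sigma>. \<forall>n\<in>hypernat_ge \<sigma> M.
        \<forall>\<^sub>F e in at_right 0. \<bar>r n e - l e\<bar> \<le> \<rho> e ^ q" for q
      using hyperlimit_iff[where r = r, OF g l r] by blast
    show "hyperCauchy \<rho> \<sigma> x"
      unfolding cauchy_iff
    proof
      fix q
      \<comment> \<open>Level \<open>Suc q\<close> leaves room for the triangle inequality through
        \<open>l\<close>: two errors add up to \<open>2 * \<rho> e * \<rho> e ^ q\<close>.\<close>
      obtain M where M: "M \<in> hypernat \<sigma>"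
        "\<And>n. n \<in> hypernat_ge \<sigma> M \<Longrightarrow> \<forall>\<^sub>F e in at_right 0. \<bar>r n e - l e\<bar> \<le> \<rho> e ^ Suc q"
        using lim by blast
      have "\<forall>\<^sub>F e in at_right 0. \<bar>r n e - r m e\<bar> \<le> \<rho> e ^ q"
        if "n \<in> hypernat_ge \<sigma> M" "m \<in> hypernat_ge \<sigma> M" for n m
        using M(2)[OF that(1)] M(2)[OF that(2)] gauge_eventually[OF g]
      proof eventually_elim
        case (elim e)
        have "2 * \<rho> e * \<rho> e ^ q \<le> 1 * \<rho> e ^ q"
          using elim by (intro mult_right_mono) auto
        with elim show ?case unfolding power_Suc by linarith
      qed
      with M(1) show "\<exists>M\<in>hypernat \<sigma>. \<forall>n\<in>hypernat_ge \<sigma> M. \<forall>m\<in>hypernat_ge \<sigma> M.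
          \<forall>\<^sub>F e in at_right 0. \<bar>r n e - r m e\<bar> \<le> \<rho> e ^ q"
        by blast
    qed
  next
    assume "hyperCauchy \<rho> \<sigma> x"
    then obtain M where M: "\<And>q. M q \<in> hypernat \<sigma>"
      "\<And>q n m. n \<in> hypernat_ge \<sigma> (M q) \<Longrightarrow> m \<in> hypernat_ge \<sigma> (M q) \<Longrightarrow>
        \<forall>\<^sub>F e in at_right 0. \<bar>r n e - r m e\<bar> \<le> \<rho> e ^ q"
      unfolding cauchy_iff by metis
    have "\<forall>q. \<exists>K. K \<in> hypernat_ge \<sigma> (M q) \<and> K \<in> hypernat_ge \<sigma> (M (Suc q))"
      using hypernat_upper_bound[OF assms(2)] M(1) by metis
    \<comment> \<open>\<open>N q\<close> and \<open>N (Suc q)\<close> both lie above \<open>M (Suc q)\<close>, so the moduli need not be made monotone.\<close>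
    then obtain N where N: "\<And>q. N q \<in> hypernat_ge \<sigma> (M q)" "\<And>q. N q \<in> hypernat_ge \<sigma> (M (Suc q))"
      by metis
    \<comment> \<open>The Cauchy condition is used at level \<open>Suc q\<close>; the bound obtained
      is then weakened by one factor \<open>\<rho> e \<le> 1\<close>.\<close>
    have "\<forall>\<^sub>F e in at_right 0. \<bar>r (N q) e - r (N (Suc q)) e\<bar> \<le> \<rho> e ^ q" for q
      using M(2)[OF N(2)[of q] N(1)[of "Suc q"]] gauge_eventually[OF g]
    proof eventually_elim
      case (elim e)
      have "\<rho> e * \<rho> e ^ q \<le> 1 * \<rho> e ^ q"
        using elim by (intro mult_right_mono) auto
      with elim show ?case unfolding power_Suc by linarith
    qed
    moreover have "r (N q) \<in> moderate \<rho>" for q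
      using r[OF ge_hypernat[OF N(1)]] by blast
    ultimately obtain l where l: "l \<in> moderate \<rho>"
      and a: "\<And>q. \<forall>\<^sub>F e in at_right 0. \<bar>r (N q) e - l e\<bar> \<le> 2 * \<rho> e ^ q"
      using net_sequence_complete[OF g, of "\<lambda>q. r (N q)"] by blast
    \<comment> \<open>An arbitrary \<open>n\<close> is compared with \<open>l\<close> through
      \<open>N (q + 2)\<close>. The errors \<open>\<rho> e ^ (q + 2)\<close> and
      \<open>2 * \<rho> e ^ (q + 2)\<close> add up to three times that power, and two spare
      exponents suffice since 3/4 is below 1.\<close>
    have "\<forall>\<^sub>F e in at_right 0. \<bar>r n e - l e\<bar> \<le> \<rho> e ^ q"
      if n: "n \<in> hypernat_ge \<sigma> (M (q + 2))" for n q
      using M(2)[OF n N(1)] a[of "q + 2"] gauge_eventually[OF g]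
    proof eventually_elim
      case (elim e)
      have "\<bar>r n e - l e\<bar> \<le> (3 * (\<rho> e * \<rho> e)) * \<rho> e ^ q"
        using elim by (simp add: power_add power2_eq_square algebra_simps)
      also have "\<rho> e * \<rho> e \<le> (1/2) * (1/2)"
        using elim by (intro mult_mono) auto
      then have "(3 * (\<rho> e * \<rho> e)) * \<rho> e ^ q \<le> 1 * \<rho> e ^ q"
        using elim by (intro mult_right_mono) auto
      finally show ?case by simp
    qed
    then have "hyperlimit \<rho> \<sigma> x (cls \<rho> l)"
      using hyperlimit_iff[where r = r, OF g l r] M(1) by blast
    then show "hyperconvergent \<rho> \<sigma> x"
      using cls_closed[OF g l] by (auto simp: hyperconvergent_def)
  qed
qed

end
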